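(* Let $D_1$ and $D_2$ be digraphs such that the underlying graph of $D_2$ is $4$-colorable. Then there is a homomorphism $D_1\to D_2$ if and only if there is a homomorphism $G[D_1]\to G[D_2]$. Furthermore, for any homomorphism $\psi:G[D_1]\to G[D_2]$, the restriction of $\psi$ to the vertices of $D_1$ is a homomorphism of $D_1$ to $D_2$.
   Context: All digraphs and graphs are finite, without loops and without parallel arcs/edges; digons (pairs of opposite arcs) are allowed in digraphs. A homomorphism of (di)graphs is a vertex map sending edges to edges (arcs to arcs, preserving direction). The graph $K_2\vee C_5$ is the complete join of $K_2$ and the $5$-cycle $C_5$: the disjoint union of $K_2$ and $C_5$ together with all edges between them. Given a digraph $D$, the (undirected) graph $G[D]$ is built by replacing each arc $u\to v$ of $D$ with its own (vertex-disjoint) copy of the gadget $K_2\vee C_5$, where the head $v$ is identified with a vertex of the $K_2$ part and the tail $u$ is identified with a vertex of the $C_5$ part; thus $V(D)\subseteq V(G[D])$, and copies corresponding to distinct arcs share only vertices of $D$.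
   Formalization: The "Furthermore" clause fails as written (for a single arc, swap the two K_2 vertices); it is proved for homomorphisms ψ that send every vertex of D_1 having no in-arc or no out-arc into V(D_2). The equivalence is unchanged. *)

theory Defs
  imports "Graph_Theory.Graph_Theory"
begin

text \<open>
  Digraphs are the locale \<^locale>\<open>digraph\<close> (finite, no loops, no parallel arcs, digons allowed).
  As in the library, an undirected graph is a symmetric digraph (locale \<^locale>\<open>graph\<close>), so that
  one notion of homomorphism serves both digraphs and undirected graphs.
\<close>

definition hom :: "('u \<Rightarrow> 'v) \<Rightarrow> ('u, 'a) pre_digraph \<Rightarrow> ('v, 'b) pre_digraph \<Rightarrow> bool" where
  "hom f G H \<longleftrightarrow>
     (\<forall>v \<in> verts G. f v \<in> verts H) \<and> (\<forall>u v. u \<rightarrow>\<^bsub>G\<^esub> v \<longrightarrow> f u \<rightarrow>\<^bsub>H\<^esub> f v)"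

definition colorable :: "nat \<Rightarrow> ('v, 'a) pre_digraph \<Rightarrow> bool" where
  "colorable k G \<longleftrightarrow>
     (\<exists>c :: 'v \<Rightarrow> nat. (\<forall>v \<in> verts G. c v < k) \<and> (\<forall>u v. u \<rightarrow>\<^bsub>G\<^esub> v \<longrightarrow> c u \<noteq> c v))"

definition complete_graph :: "nat \<Rightarrow> nat pair_pre_digraph" where
  "complete_graph n =
     \<lparr> pverts = {..<n}, parcs = {(i, j). i < n \<and> j < n \<and> i \<noteq> j} \<rparr>"

definition cycle_graph :: "nat \<Rightarrow> nat pair_pre_digraph" where
  "cycle_graph n =
     \<lparr> pverts = {..<n},
       parcs = {(i, j). i < n \<and> j < n \<and> (j = Suc i mod n \<or> i = Suc j mod n)} \<rparr>"

definition graph_join ::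
  "'u pair_pre_digraph \<Rightarrow> 'v pair_pre_digraph \<Rightarrow> ('u + 'v) pair_pre_digraph" where
  "graph_join G H =
     \<lparr> pverts = Inl ` pverts G \<union> Inr ` pverts H,
       parcs = map_prod Inl Inl ` parcs G \<union> map_prod Inr Inr ` parcs H
             \<union> Inl ` pverts G \<times> Inr ` pverts H \<union> Inr ` pverts H \<times> Inl ` pverts G \<rparr>"

definition gadget :: "(nat + nat) pair_pre_digraph" where
  "gadget = graph_join (complete_graph 2) (cycle_graph 5)"

text \<open>
  Vertices of \<open>G[D]\<close>: \<open>Base v\<close> is the vertex \<open>v\<close> of \<open>D\<close>, and \<open>Inner a x\<close> is the vertex \<open>x\<close> of the
  copy of the gadget that replaces the arc \<open>a\<close>, for \<open>x\<close> not identified with an end of \<open>a\<close>. The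
  vertices \<open>Inl 0\<close> (of \<open>K\<^sub>2\<close>) and \<open>Inr 0\<close> (of \<open>C\<^sub>5\<close>) are the ones identified with the head and the
  tail; other choices give isomorphic graphs.
\<close>

datatype ('v, 'a) gvert = Base 'v | Inner 'a "nat + nat"

definition place :: "('v, 'a) pre_digraph \<Rightarrow> 'a \<Rightarrow> nat + nat \<Rightarrow> ('v, 'a) gvert" where
  "place D a x =
     (if x = Inl 0 then Base (head D a) else if x = Inr 0 then Base (tail D a) else Inner a x)"

definition gadget_graph :: "('v, 'a) pre_digraph \<Rightarrow> ('v, 'a) gvert pair_pre_digraph" where
  "gadget_graph D =
     \<lparr> pverts = Base ` verts D \<union> (\<Union>a \<in> arcs D. place D a ` pverts gadget),
       parcs = (\<Union>a \<in> arcs D. map_prod (place D a) (place D a) ` parcs gadget) \<rparr>"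

lemma gadget_simps:
  "pverts gadget = Inl ` {..<2} \<union> Inr ` {..<5}"
  "(Inl i, Inl j) \<in> parcs gadget \<longleftrightarrow> i < 2 \<and> j < 2 \<and> i \<noteq> j"
  "(Inr i, Inr j) \<in> parcs gadget \<longleftrightarrow>
     i < 5 \<and> j < 5 \<and> (j = Suc i mod 5 \<or> i = Suc j mod 5)"
  "(Inl i, Inr j) \<in> parcs gadget \<longleftrightarrow> i < 2 \<and> j < 5"
  "(Inr j, Inl i) \<in> parcs gadget \<longleftrightarrow> i < 2 \<and> j < 5"
  by (auto simp: gadget_def graph_join_def complete_graph_def cycle_graph_def)

lemma pair_graph_gadget: "pair_graph gadget"
proof -
  have sub: "parcs gadget \<subseteq> pverts gadget \<times> pverts gadget"
    by (auto simp: gadget_def graph_join_def complete_graph_def cycle_graph_def)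
  have fin: "finite (pverts gadget)"
    by (simp add: gadget_simps)
  have sym: "(y, x) \<in> parcs gadget" if "(x, y) \<in> parcs gadget" for x y
    using that by (cases x; cases y) (auto simp: gadget_simps)
  have irr: "(x, x) \<notin> parcs gadget" for x
  proof (cases x)
    case (Inr i)
    have "i < 5 \<Longrightarrow> i \<noteq> Suc i mod 5" by presburger
    then show ?thesis using Inr by (auto simp: gadget_simps)
  qed (auto simp: gadget_simps)
  show ?thesis
  proof unfold_locales
    show "finite (parcs gadget)"
      using sub fin by (meson finite_SigmaI finite_subset)
    show "symmetric gadget"
      unfolding symmetric_def by (auto intro!: symI sym)
  qed (use sub fin irr in auto)
qed

lemma inj_place: "tail D a \<noteq> head D a \<Longrightarrow> place D a x = place D a y \<Longrightarrow> x = y"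
  by (auto simp: place_def split: if_splits)

lemma pair_graph_gadget_graph:
  assumes "digraph D"
  shows "pair_graph (gadget_graph D)"
proof -
  interpret D: digraph D by (rule assms)
  interpret g: pair_graph gadget by (rule pair_graph_gadget)
  have g_sym: "(y, x) \<in> parcs gadget" if "(x, y) \<in> parcs gadget" for x y
    using that g.sym_arcs by (auto simp: symmetric_def sym_def)
  show ?thesis
  proof unfold_locales
    fix e assume e: "e \<in> parcs (gadget_graph D)"
    then obtain a x y where a: "a \<in> arcs D" "(x, y) \<in> parcs gadget"
      and e_eq: "e = (place D a x, place D a y)"
      by (auto simp: gadget_graph_def)
    show "fst e \<in> pverts (gadget_graph D)" "snd e \<in> pverts (gadget_graph D)"
      using a e_eq g.in_arcsD1[OF a(2)] g.in_arcsD2[OF a(2)] by (auto simp: gadget_graph_def)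
    have "x \<noteq> y" using g.pair_no_loops[OF a(2)] by simp
    then show "fst e \<noteq> snd e"
      using inj_place[of D a x y] D.no_loops[OF a(1)] e_eq by auto
  next
    show "symmetric (gadget_graph D)"
      unfolding symmetric_def
    proof (rule symI)
      fix u v assume "u \<rightarrow>\<^bsub>gadget_graph D\<^esub> v"
      then obtain a x y where "a \<in> arcs D" "(x, y) \<in> parcs gadget" "u = place D a x" "v = place D a y"
        by (auto simp: gadget_graph_def)
      then show "v \<rightarrow>\<^bsub>gadget_graph D\<^esub> u"
        using g_sym[of x y] map_prod_imageI[of y x "parcs gadget" "place D a" "place D a"]
        by (auto simp: gadget_graph_def)
    qed
  qed (auto simp: gadget_graph_def g.pair_finite_verts g.pair_finite_arcs)
qed

text \<open>
  A homomorphism \<open>G[D\<^sub>1] \<rightarrow> G[D\<^sub>2]\<close> need not send \<open>V(D\<^sub>1)\<close> into \<open>V(D\<^sub>2)\<close>, even when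
  \<open>D\<^sub>1 = D\<^sub>2\<close> is a single arc: exchange the two vertices of \<open>K\<^sub>2\<close>. Only sources and sinks
  (isolated vertices included) can leave \<open>V(D\<^sub>2)\<close>, as any other vertex lies in the \<open>K\<^sub>2\<close> of one
  copy of the gadget and in the \<open>C\<^sub>5\<close> of another. Hence a statement on the restriction of a
  homomorphism to \<open>V(D\<^sub>1)\<close> has to ask that sources and sinks be sent into \<open>V(D\<^sub>2)\<close>.
\<close>

lemma restriction_may_leave_base:
  obtains D :: "(nat, unit) pre_digraph" and \<psi>
  where "digraph D" "colorable 4 (mk_symmetric D)"
    "hom \<psi> (gadget_graph D) (gadget_graph D)"
    "\<not> (\<exists>\<phi>. hom \<phi> D D \<and> (\<forall>v \<in> verts D. \<psi> (Base v) = Base (\<phi> v)))"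
proof -
  define D :: "(nat, unit) pre_digraph" where
    "D = \<lparr> verts = {0, 1}, arcs = {()}, tail = (\<lambda>_. 0), head = (\<lambda>_. 1) \<rparr>"
  define \<psi> :: "(nat, unit) gvert \<Rightarrow> (nat, unit) gvert" where
    "\<psi> w = (if w = Base 1 then Inner () (Inl 1) else if w = Inner () (Inl 1) then Base 1 else w)"
    for w
  define s :: "nat + nat \<Rightarrow> nat + nat" where
    "s x = (if x = Inl 0 then Inl 1 else if x = Inl 1 then Inl 0 else x)" for x
  have \<psi>_place: "\<psi> (place D () x) = place D () (s x)" for x
    by (auto simp: \<psi>_def place_def s_def D_def)
  have s_verts: "s x \<in> pverts gadget" if "x \<in> pverts gadget" for x
    using that by (auto simp: s_def gadget_simps)
  have s_arcs: "(s x, s y) \<in> parcs gadget" if "(x, y) \<in> parcs gadget" for x y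
    using that by (cases x; cases y) (auto simp: s_def gadget_simps)
  have "digraph D"
    by unfold_locales (auto simp: D_def)
  moreover have "colorable 4 (mk_symmetric D)"
    unfolding colorable_def
    by (rule exI[of _ id]) (auto simp: D_def parcs_mk_symmetric)
  moreover have "hom \<psi> (gadget_graph D) (gadget_graph D)"
  proof -
    have verts: "pverts (gadget_graph D) = place D () ` pverts gadget"
    proof -
      have "Base 0 = place D () (Inr 0)" "Base 1 = place D () (Inl 0)"
        by (auto simp: place_def D_def)
      then show ?thesis by (auto simp: gadget_graph_def gadget_simps D_def)
    qed
    have arcs: "parcs (gadget_graph D) = map_prod (place D ()) (place D ()) ` parcs gadget"
      by (auto simp: gadget_graph_def D_def)
    show ?thesis
      unfolding hom_def by (auto simp: verts arcs \<psi>_place s_verts intro!: map_prod_imageI s_arcs)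
  qed
  moreover have "\<not> (\<exists>\<phi>. hom \<phi> D D \<and> (\<forall>v \<in> verts D. \<psi> (Base v) = Base (\<phi> v)))"
    by (simp add: D_def \<psi>_def)
  ultimately show thesis by (rule that)
qed

end

theory Submission
  imports Defs
begin

text \<open>
  The gadget \<open>W = K\<^sub>2 \<or> C\<^sub>5\<close> is not 4-colorable, but deleting any vertex makes it 4-colorable with
  arbitrary distinct colors prescribed at the two identified vertices. So if the image of a
  homomorphism \<open>W \<rightarrow> G[D]\<close> missed a vertex of every copy of \<open>W\<close>, a 4-coloring of \<open>D\<close> would extend
  over that image, and \<open>W\<close> would be 4-colorable. Hence the image is exactly one copy of \<open>W\<close>, and as
  the vertices of \<open>K\<^sub>2\<close> are the universal vertices of \<open>W\<close>, the parts \<open>K\<^sub>2\<close> and \<open>C\<^sub>5\<close> are preserved.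
  Sending the \<open>K\<^sub>2\<close> part of each copy to the head of its arc and the \<open>C\<^sub>5\<close> part to the tail therefore
  turns a homomorphism \<open>G[D\<^sub>1] \<rightarrow> G[D\<^sub>2]\<close> into one \<open>D\<^sub>1 \<rightarrow> D\<^sub>2\<close>.
\<close>

section \<open>Colorings of the gadget\<close>

text \<open>The two vertices of \<open>K\<^sub>2\<close> use up two colors that cannot recur on
  \<open>C\<^sub>5\<close>, and an odd cycle cannot be colored with the remaining two.\<close>

lemma gadget_not_4_colorable: "\<not> colorable 4 (with_proj gadget)"
proof
  assume "colorable 4 (with_proj gadget)"
  then obtain c :: "nat + nat \<Rightarrow> nat" where
    lt: "\<And>x. x \<in> pverts gadget \<Longrightarrow> c x < 4" and
    neq: "\<And>x y. (x, y) \<in> parcs gadget \<Longrightarrow> c x \<noteq> c y"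
    unfolding colorable_def by auto
  let ?p = "c (Inl 0)" and ?q = "c (Inl 1)"
  have "?p \<noteq> ?q" "?p < 4" "?q < 4"
    by (auto intro!: neq lt simp: gadget_simps)
  then have "card ({..<4} - {?p, ?q}) = 2"
    by (simp add: card_Diff_subset)
  then obtain x y where xy: "{..<4} - {?p, ?q} = {x, y}"
    by (auto simp: card_2_iff)
  have C5: "c (Inr i) = x \<or> c (Inr i) = y" if "i < 5" for i
  proof -
    have "c (Inr i) \<in> {..<4} - {?p, ?q}"
      using that lt[of "Inr i"] neq[of "Inr i" "Inl 0"] neq[of "Inr i" "Inl 1"]
      by (auto simp: gadget_simps)
    then show ?thesis unfolding xy by simp
  qed
  have "c (Inr 0) \<noteq> c (Inr 1)" "c (Inr 1) \<noteq> c (Inr 2)" "c (Inr 2) \<noteq> c (Inr 3)"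
    "c (Inr 3) \<noteq> c (Inr 4)" "c (Inr 4) \<noteq> c (Inr 0)"
    by (auto intro!: neq simp: gadget_simps)
  then show False
    using C5[of 0] C5[of 1] C5[of 2] C5[of 3] C5[of 4] by auto
qed

text \<open>Without a vertex of \<open>K\<^sub>2\<close>, three colors are left for the cycle;
  without a vertex of \<open>C\<^sub>5\<close>, only a path remains and two colors suffice for it.
  The prescribed values hold even if \<open>m\<close> is itself an identified vertex, so that
  colorings of different copies agree wherever the copies meet.\<close>

lemma gadget_minus_vertex_4_coloring:
  fixes h t :: nat
  assumes m: "m \<in> pverts gadget" and ht: "h < 4" "t < 4" "h \<noteq> t"
  obtains k :: "nat + nat \<Rightarrow> nat" where
    "k (Inl 0) = h" "k (Inr 0) = t" "\<And>x. k x < 4"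
    "\<And>x y. (x, y) \<in> parcs gadget \<Longrightarrow> x \<noteq> m \<Longrightarrow> y \<noteq> m \<Longrightarrow> k x \<noteq> k y"
proof -
  have "card ({..<4} - {h, t}) = 2"
    using ht by (simp add: card_Diff_subset)
  then obtain s w where "s \<noteq> w" "{..<4} - {h, t} = {s, w}"
    by (auto simp: card_2_iff)
  then have sw: "s \<noteq> w" "s < 4" "w < 4" "s \<noteq> h" "s \<noteq> t" "w \<noteq> h" "w \<noteq> t"
    by blast+
  have lt5: "i = 0 \<or> i = 1 \<or> i = 2 \<or> i = 3 \<or> i = 4" if "i < 5" for i :: nat
    using that by presburger
  have C5: "i = 0 \<and> j = 1 \<or> i = 1 \<and> j = 2 \<or> i = 2 \<and> j = 3 \<or> i = 3 \<and> j = 4 \<or> i = 4 \<and> j = 0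
    \<or> i = 1 \<and> j = 0 \<or> i = 2 \<and> j = 1 \<or> i = 3 \<and> j = 2 \<or> i = 4 \<and> j = 3 \<or> i = 0 \<and> j = 4"
    if "(Inr i, Inr j) \<in> parcs gadget" for i j
  proof -
    have "i < 5" "j < 5" "j = Suc i mod 5 \<or> i = Suc j mod 5"
      using that by (auto simp: gadget_simps)
    from lt5[OF this(1)] lt5[OF this(2)] this(3) show ?thesis by (elim disjE) simp_all
  qed
  have lt2: "i = 0 \<or> i = 1" if "i < 2" for i :: nat
    using that by presburger
  show thesis
  proof (cases m)
    case (Inl n)
    \<comment> \<open>Giving \<open>h\<close> to both vertices of \<open>K\<^sub>2\<close> is
      harmless since one of them is \<open>m\<close>. On the cycle \<open>t\<close> occurs at
      \<open>Inr 0\<close> only, and \<open>s\<close>, \<open>w\<close> alternate along the path 1,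
      2, 3, 4.\<close>
    define k where "k x = (case x of Inl _ \<Rightarrow> h
      | Inr j \<Rightarrow> if j = 0 then t else if odd j then s else w)" for x :: "nat + nat"
    show thesis
    proof (rule that[of k])
      show "k x < 4" for x
        using ht sw by (auto simp: k_def split: sum.split)
      show "k x \<noteq> k y" if "(x, y) \<in> parcs gadget" "x \<noteq> m" "y \<noteq> m" for x y
      proof (cases x; cases y)
        fix i j assume xy: "x = Inr i" "y = Inr j"
        show ?thesis
          using C5[of i j] that(1) xy ht sw by (auto simp: k_def)
      next
        fix i j assume xy: "x = Inl i" "y = Inl j"
        have "n < 2" "i < 2" "j < 2" "i \<noteq> j" "i \<noteq> n" "j \<noteq> n"
          using that xy m Inl by (auto simp: gadget_simps)
        then show ?thesis by linarith
      qed (use ht sw in \<open>auto simp: k_def\<close>)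
    qed (auto simp: k_def)
  next
    case (Inr n)
    \<comment> \<open>the parity flips past \<open>n\<close> because the path \<open>C\<^sub>5 - n\<close> runs through the edge \<open>{4, 0}\<close>\<close>
    define k where "k x = (case x of Inl i \<Rightarrow> if i = 0 then h else s
      | Inr j \<Rightarrow> if j < n \<and> odd j \<or> n < j \<and> even j then w else t)" for x :: "nat + nat"
    show thesis
    proof (rule that[of k])
      show "k x < 4" for x
        using ht sw by (auto simp: k_def split: sum.split)
      show "k x \<noteq> k y" if "(x, y) \<in> parcs gadget" "x \<noteq> m" "y \<noteq> m" for x y
      proof (cases x; cases y)
        fix i j assume xy: "x = Inr i" "y = Inr j"
        have "n < 5"
          using m Inr by (auto simp: gadget_simps)
        moreover have "i \<noteq> n" "j \<noteq> n"
          using that xy Inr by auto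
        ultimately have "(j < n \<and> odd j \<or> n < j \<and> even j) \<noteq> (i < n \<and> odd i \<or> n < i \<and> even i)"
          using C5[OF that(1)[unfolded xy]] by (auto dest!: lt5)
        then show ?thesis using xy sw by (auto simp: k_def)
      qed (use that ht sw in \<open>auto simp: k_def gadget_simps dest!: lt2\<close>)
    qed (auto simp: k_def)
  qed
qed

section \<open>Homomorphisms from the gadget into a gadget graph\<close>

text \<open>Each copy is an induced subgraph: an edge from another copy can join two of its vertices
  only if both are ends of the arc, and these are already adjacent in the gadget. This case occurs
  for digons.\<close>

lemma place_arc_imp_gadget_arc:
  assumes "digraph D" "a \<in> arcs D" "(place D a x, place D a y) \<in> parcs (gadget_graph D)"
  shows "(x, y) \<in> parcs gadget"
proof -
  interpret D: digraph D by (rule assms(1))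
  interpret g: pair_graph gadget by (rule pair_graph_gadget)
  obtain b x' y' where b: "b \<in> arcs D" "(x', y') \<in> parcs gadget"
    and eq: "place D a x = place D b x'" "place D a y = place D b y'"
    using assms(3) by (auto simp: gadget_graph_def)
  have loops: "tail D a \<noteq> head D a" "tail D b \<noteq> head D b"
    using D.no_loops assms(2) b(1) by auto
  show ?thesis
  proof (cases "a = b")
    case True
    then show ?thesis using b eq inj_place[OF loops(2)] by metis
  next
    case False
    have "x' \<noteq> y'" using g.pair_no_loops[OF b(2)] by auto
    then have "x \<noteq> y" using eq inj_place[OF loops(2)] by metis
    moreover have "x = Inl 0 \<or> x = Inr 0" "y = Inl 0 \<or> y = Inr 0"
      using False eq by (auto simp: place_def split: if_splits)
    ultimately show ?thesis by (auto simp: gadget_simps)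
  qed
qed

lemma gadget_hom_covers_copy:
  assumes D: "digraph D" and col: "colorable 4 (mk_symmetric D)"
    and f: "hom f (with_proj gadget) (with_proj (gadget_graph D))"
  obtains a where "a \<in> arcs D" "place D a ` pverts gadget \<subseteq> f ` pverts gadget"
proof (rule ccontr)
  assume "\<not> thesis"
  then have "\<forall>a \<in> arcs D. \<exists>m \<in> pverts gadget. place D a m \<notin> f ` pverts gadget"
    using that by blast
  then obtain m where m: "\<And>a. a \<in> arcs D \<Longrightarrow> m a \<in> pverts gadget"
    "\<And>a. a \<in> arcs D \<Longrightarrow> place D a (m a) \<notin> f ` pverts gadget"
    by metis
  interpret D: digraph D by (rule D)
  interpret g: pair_graph gadget by (rule pair_graph_gadget)
  obtain c :: "'a \<Rightarrow> nat" where c_lt: "\<And>v. v \<in> verts D \<Longrightarrow> c v < 4"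
    and c_neq: "\<And>u v. u \<rightarrow>\<^bsub>mk_symmetric D\<^esub> v \<Longrightarrow> c u \<noteq> c v"
    using col unfolding colorable_def by auto
  have c_arc: "c (head D a) \<noteq> c (tail D a)" if "a \<in> arcs D" for a
    using c_neq[of "head D a" "tail D a"] that
    by (auto simp: parcs_mk_symmetric)
  \<comment> \<open>A coloring of the copy at \<open>a\<close> that extends \<open>c\<close> from
    the ends of \<open>a\<close> and is proper away from the missed vertex
    \<open>m a\<close>.\<close>
  define good where "good a k \<longleftrightarrow> k (Inl 0) = c (head D a) \<and> k (Inr 0) = c (tail D a) \<and> (\<forall>x. k x < 4)
    \<and> (\<forall>x y. (x, y) \<in> parcs gadget \<longrightarrow> x \<noteq> m a \<longrightarrow> y \<noteq> m a \<longrightarrow> k x \<noteq> k y)"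
    for a and k :: "nat + nat \<Rightarrow> nat"
  have "\<exists>k. good a k" if a: "a \<in> arcs D" for a
    by (rule gadget_minus_vertex_4_coloring[OF m(1)[OF a], of "c (head D a)" "c (tail D a)"])
      (use a c_arc[OF a] c_lt in \<open>auto simp: good_def\<close>)
  then obtain k where "\<And>a. a \<in> arcs D \<Longrightarrow> good a (k a)"
    by metis
  then have k:
    "\<And>a. a \<in> arcs D \<Longrightarrow> k a (Inl 0) = c (head D a)"
    "\<And>a. a \<in> arcs D \<Longrightarrow> k a (Inr 0) = c (tail D a)"
    "\<And>a x. a \<in> arcs D \<Longrightarrow> k a x < (4 :: nat)"
    "\<And>a x y. a \<in> arcs D \<Longrightarrow> (x, y) \<in> parcs gadget \<Longrightarrow> x \<noteq> m a \<Longrightarrow> y \<noteq> m a \<Longrightarrow> k a x \<noteq> k a y"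
    by (auto simp: good_def)
  \<comment> \<open>All colorings \<open>k a\<close> agree with \<open>c\<close> on the base, so
    they glue to one coloring. It is proper on every edge that avoids the missed vertices, hence on
    all edges \<open>f x\<close>, \<open>f y\<close>.\<close>
  define K where "K w = (case w of Base v \<Rightarrow> c v | Inner a x \<Rightarrow> k a x)" for w
  have K_place: "K (place D a x) = k a x" if "a \<in> arcs D" for a x
    using that k(1,2) by (auto simp: K_def place_def)
  have f_verts: "f x \<in> pverts (gadget_graph D)" if "x \<in> pverts gadget" for x
    using f that by (auto simp: hom_def)
  have f_arcs: "(f x, f y) \<in> parcs (gadget_graph D)" if "(x, y) \<in> parcs gadget" for x y
    using f that by (auto simp: hom_def)
  have "K (f x) < 4" if "x \<in> pverts gadget" for x
    using f_verts[OF that] K_place k(3) c_lt by (auto simp: gadget_graph_def K_def)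
  moreover have "K (f x) \<noteq> K (f y)" if xy: "(x, y) \<in> parcs gadget" for x y
  proof -
    obtain a x' y' where a: "a \<in> arcs D" "(x', y') \<in> parcs gadget"
      and eq: "f x = place D a x'" "f y = place D a y'"
      using f_arcs[OF xy] by (auto simp: gadget_graph_def)
    have "x' \<noteq> m a" "y' \<noteq> m a"
      using m(2)[OF a(1)] imageI[OF g.in_arcsD1[OF xy], of f] imageI[OF g.in_arcsD2[OF xy], of f] eq
      by auto
    then show ?thesis using k(4)[OF a] eq K_place[OF a(1)] by simp
  qed
  ultimately have "colorable 4 (with_proj gadget)"
    unfolding colorable_def by (intro exI[of _ "\<lambda>x. K (f x)"]) auto
  then show False using gadget_not_4_colorable by contradiction
qed

lemma gadget_hom_preserves_parts:
  assumes D: "digraph D" and col: "colorable 4 (mk_symmetric D)"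
    and f: "hom f (with_proj gadget) (with_proj (gadget_graph D))"
  obtains a where "a \<in> arcs D"
    "\<And>i. i < 2 \<Longrightarrow> f (Inl i) \<in> place D a ` range Inl"
    "\<And>j. j < 5 \<Longrightarrow> f (Inr j) \<in> place D a ` range Inr"
proof -
  interpret D: digraph D by (rule D)
  interpret g: pair_graph gadget by (rule pair_graph_gadget)
  obtain a where a: "a \<in> arcs D" and sub: "place D a ` pverts gadget \<subseteq> f ` pverts gadget"
    using gadget_hom_covers_copy[OF D col f] .
  have inj_pl: "inj (place D a)"
    using inj_place[of D a] D.no_loops[OF a] by (auto intro: injI)
  have card: "card (place D a ` pverts gadget) = card (pverts gadget)"
    by (rule card_image) (rule inj_on_subset[OF inj_pl subset_UNIV])
  \<comment> \<open>The image has at most as many vertices as the gadget, and the copy inside it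
    already has that many. Equality also forces \<open>f\<close> to be injective.\<close>
  have im: "f ` pverts gadget = place D a ` pverts gadget"
    using card_seteq[OF _ sub] card card_image_le[OF g.pair_finite_verts, of f] by auto
  then have inj_f: "inj_on f (pverts gadget)"
    using card by (intro eq_card_imp_inj_on) auto
  have f_arcs: "(f x, f y) \<in> parcs (gadget_graph D)" if "(x, y) \<in> parcs gadget" for x y
    using f that by (auto simp: hom_def)
  have K2: "\<exists>i' < 2. f (Inl i) = place D a (Inl i')" if i: "i < 2" for i
  proof -
    have "f (Inl i) \<in> place D a ` pverts gadget"
      unfolding im[symmetric] using i by (intro imageI) (simp add: gadget_simps)
    then obtain z where z: "z \<in> pverts gadget" "f (Inl i) = place D a z" by blast
    show ?thesis
    proof (cases z)
      case (Inl i')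
      then show ?thesis using z by (auto simp: gadget_simps)
    next
      case (Inr j)
      then have j: "j < 5" using z by (auto simp: gadget_simps)
      \<comment> \<open>the image of a universal vertex is universal, but \<open>Inr j\<close> has a non-neighbour\<close>
      let ?z' = "Inr ((j + 2) mod 5)"
      have "place D a ?z' \<in> f ` pverts gadget"
        unfolding im by (auto simp: gadget_simps)
      then obtain y where y: "y \<in> pverts gadget" "f y = place D a ?z'" by auto
      have "(j + 2) mod 5 \<noteq> j" using j by presburger
      then have "y \<noteq> Inl i"
        using y z Inr inj_eq[OF inj_pl] by auto
      then have "(Inl i, y) \<in> parcs gadget"
        using y i by (cases y) (auto simp: gadget_simps)
      then have "(Inr j, ?z') \<in> parcs gadget"
        using f_arcs y(2) z(2) Inr place_arc_imp_gadget_arc[OF D a] by metis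
      moreover have "(j + 2) mod 5 \<noteq> Suc j mod 5" "j \<noteq> Suc ((j + 2) mod 5) mod 5"
        using j by presburger+
      ultimately show ?thesis by (auto simp: gadget_simps)
    qed
  qed
  have C5: "f (Inr j) \<in> place D a ` range Inr" if j: "j < 5" for j
  proof -
    have "f (Inr j) \<in> place D a ` pverts gadget"
      unfolding im[symmetric] using j by (intro imageI) (simp add: gadget_simps)
    then obtain z where z: "z \<in> pverts gadget" "f (Inr j) = place D a z" by blast
    \<comment> \<open>By counting, \<open>f\<close> maps \<open>K\<^sub>2\<close> onto the
      \<open>K\<^sub>2\<close> of the copy, so injectivity leaves no room there for vertices of
      \<open>C\<^sub>5\<close>.\<close>
    have "f ` Inl ` {..<2} = place D a ` Inl ` {..<2}"
    proof (rule card_seteq)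
      show "f ` Inl ` {..<2} \<subseteq> place D a ` Inl ` {..<2}" using K2 by blast
      have "inj_on f (Inl ` {..<2})"
        by (rule inj_on_subset[OF inj_f]) (auto simp: gadget_simps)
      then show "card (place D a ` Inl ` {..<2}) \<le> card (f ` Inl ` {..<2})"
        by (simp add: card_image inj_on_subset[OF inj_pl])
    qed simp
    moreover have "f (Inr j) \<notin> f ` Inl ` {..<2}"
      using j by (subst inj_on_image_mem_iff[OF inj_f]) (auto simp: gadget_simps)
    ultimately have "z \<notin> Inl ` {..<2}" using z by auto
    then show ?thesis using z by (auto simp: gadget_simps)
  qed
  show thesis
    by (rule that[OF a _ C5]) (use K2 in blast)+
qed

section \<open>Passing between homomorphisms of digraphs and of gadget graphs\<close>

text \<open>Choose for each arc \<open>a\<close> an arc \<open>g a\<close> joining the images of its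
  ends, and carry the copy at \<open>a\<close> identically onto the copy at
  \<open>g a\<close>.\<close>

lemma hom_imp_gadget_graph_hom:
  assumes "hom \<phi> D1 D2"
  shows "\<exists>\<psi>. hom \<psi> (with_proj (gadget_graph D1)) (with_proj (gadget_graph D2))"
proof -
  have "\<exists>b. b \<in> arcs D2 \<and> tail D2 b = \<phi> (tail D1 a) \<and> head D2 b = \<phi> (head D1 a)"
    if "a \<in> arcs D1" for a
  proof -
    have "tail D1 a \<rightarrow>\<^bsub>D1\<^esub> head D1 a"
      using that by (auto simp: arcs_ends_def arc_to_ends_def)
    then have "\<phi> (tail D1 a) \<rightarrow>\<^bsub>D2\<^esub> \<phi> (head D1 a)"
      using assms by (auto simp: hom_def)
    then show ?thesis by (auto simp: arcs_ends_def arc_to_ends_def)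
  qed
  then obtain g where g: "\<And>a. a \<in> arcs D1 \<Longrightarrow> g a \<in> arcs D2"
    "\<And>a. a \<in> arcs D1 \<Longrightarrow> tail D2 (g a) = \<phi> (tail D1 a)"
    "\<And>a. a \<in> arcs D1 \<Longrightarrow> head D2 (g a) = \<phi> (head D1 a)"
    by metis
  define \<psi> where "\<psi> w = (case w of Base v \<Rightarrow> Base (\<phi> v) | Inner a x \<Rightarrow> Inner (g a) x)" for w
  have \<psi>_place: "\<psi> (place D1 a x) = place D2 (g a) x" if "a \<in> arcs D1" for a x
    using that g by (auto simp: \<psi>_def place_def)
  have \<psi>_Base: "\<psi> (Base v) = Base (\<phi> v)" for v by (simp add: \<psi>_def)
  have "hom \<psi> (with_proj (gadget_graph D1)) (with_proj (gadget_graph D2))"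
    unfolding hom_def
  proof (intro conjI ballI allI impI)
    fix w assume "w \<in> verts (with_proj (gadget_graph D1))"
    then consider v where "v \<in> verts D1" "w = Base v"
      | a x where "a \<in> arcs D1" "x \<in> pverts gadget" "w = place D1 a x"
      by (auto simp: gadget_graph_def)
    then show "\<psi> w \<in> verts (with_proj (gadget_graph D2))"
    proof cases
      case 1
      then show ?thesis using assms by (simp add: gadget_graph_def \<psi>_Base hom_def)
    next
      case (2 a x)
      then show ?thesis using g(1)[of a] by (auto simp: gadget_graph_def \<psi>_place)
    qed
  next
    fix u v assume "u \<rightarrow>\<^bsub>with_proj (gadget_graph D1)\<^esub> v"
    then obtain a x y where "a \<in> arcs D1" "(x, y) \<in> parcs gadget"
      "u = place D1 a x" "v = place D1 a y"
      by (auto simp: gadget_graph_def)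
    then show "\<psi> u \<rightarrow>\<^bsub>with_proj (gadget_graph D2)\<^esub> \<psi> v"
      using g(1)[of a] by (auto simp: gadget_graph_def \<psi>_place intro!: bexI[of _ "g a"] map_prod_imageI)
  qed
  then show ?thesis by blast
qed

text \<open>Collapses the two parts of each copy to the ends of its arc. Being defined off the base
  as well, it yields a vertex of the digraph even where a homomorphism moves a source or sink off
  the base.\<close>

fun gadget_end :: "('v, 'a) pre_digraph \<Rightarrow> ('v, 'a) gvert \<Rightarrow> 'v" where
  "gadget_end D (Base v) = v"
| "gadget_end D (Inner a (Inl i)) = head D a"
| "gadget_end D (Inner a (Inr j)) = tail D a"

lemma gadget_end_place [simp]:
  "gadget_end D (place D a (Inl i)) = head D a"
  "gadget_end D (place D a (Inr j)) = tail D a"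
  by (auto simp: place_def)

lemma gadget_end_in_verts:
  assumes "wf_digraph D" "w \<in> pverts (gadget_graph D)"
  shows "gadget_end D w \<in> verts D"
proof -
  interpret wf_digraph D by (rule assms(1))
  show ?thesis using assms(2) by (auto simp: gadget_graph_def gadget_simps)
qed

text \<open>Restrict \<open>\<psi>\<close> to the copy at \<open>a\<close> and look at the
  identified vertices \<open>Inl 0\<close> and \<open>Inr 0\<close>. That one \<open>b\<close>
  serves both ends, with the parts kept apart, is what preserves the direction of arcs.\<close>

lemma gadget_graph_hom_arc:
  assumes D2: "digraph D2" "colorable 4 (mk_symmetric D2)"
    and \<psi>: "hom \<psi> (with_proj (gadget_graph D1)) (with_proj (gadget_graph D2))"
    and a: "a \<in> arcs D1"
  obtains b where "b \<in> arcs D2"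
    "\<psi> (Base (head D1 a)) \<in> place D2 b ` range Inl"
    "\<psi> (Base (tail D1 a)) \<in> place D2 b ` range Inr"
proof -
  have f: "hom (\<lambda>x. \<psi> (place D1 a x)) (with_proj gadget) (with_proj (gadget_graph D2))"
    unfolding hom_def
  proof (intro conjI ballI allI impI)
    fix x assume "x \<in> verts (with_proj gadget)"
    then have "place D1 a x \<in> pverts (gadget_graph D1)"
      using a by (auto simp: gadget_graph_def)
    then show "\<psi> (place D1 a x) \<in> verts (with_proj (gadget_graph D2))"
      using \<psi> by (auto simp: hom_def)
  next
    fix x y assume "x \<rightarrow>\<^bsub>with_proj gadget\<^esub> y"
    then have "(place D1 a x, place D1 a y) \<in> parcs (gadget_graph D1)"
      using a by (auto simp: gadget_graph_def intro!: bexI[of _ a] map_prod_imageI)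
    then show "\<psi> (place D1 a x) \<rightarrow>\<^bsub>with_proj (gadget_graph D2)\<^esub> \<psi> (place D1 a y)"
      using \<psi> by (auto simp: hom_def)
  qed
  obtain b where b: "b \<in> arcs D2"
    "\<And>i. i < 2 \<Longrightarrow> \<psi> (place D1 a (Inl i)) \<in> place D2 b ` range Inl"
    "\<And>j. j < 5 \<Longrightarrow> \<psi> (place D1 a (Inr j)) \<in> place D2 b ` range Inr"
    using gadget_hom_preserves_parts[OF D2 f] by blast
  show thesis
    by (rule that[OF b(1)]) (use b(2)[of 0] b(3)[of 0] in \<open>auto simp: place_def\<close>)
qed

lemma gadget_graph_hom_imp_hom:
  assumes D2: "digraph D2" "colorable 4 (mk_symmetric D2)"
    and \<psi>: "hom \<psi> (with_proj (gadget_graph D1)) (with_proj (gadget_graph D2))"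
  shows "hom (\<lambda>v. gadget_end D2 (\<psi> (Base v))) D1 D2"
proof -
  interpret D2: digraph D2 by (rule D2)
  show ?thesis
    unfolding hom_def
  proof (intro conjI ballI allI impI)
    fix v assume "v \<in> verts D1"
    then have "\<psi> (Base v) \<in> pverts (gadget_graph D2)"
      using \<psi> by (auto simp: hom_def gadget_graph_def)
    then show "gadget_end D2 (\<psi> (Base v)) \<in> verts D2"
      by (rule gadget_end_in_verts[OF D2.wf_digraph_axioms])
  next
    fix u v assume "u \<rightarrow>\<^bsub>D1\<^esub> v"
    then obtain a where a: "a \<in> arcs D1" "tail D1 a = u" "head D1 a = v"
      by (auto simp: arcs_ends_def arc_to_ends_def)
    obtain b where "b \<in> arcs D2" "\<psi> (Base (head D1 a)) \<in> place D2 b ` range Inl"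
      "\<psi> (Base (tail D1 a)) \<in> place D2 b ` range Inr"
      using gadget_graph_hom_arc[OF D2 \<psi> a(1)] .
    then show "gadget_end D2 (\<psi> (Base u)) \<rightarrow>\<^bsub>D2\<^esub> gadget_end D2 (\<psi> (Base v))"
      using a by (auto simp: arcs_ends_def arc_to_ends_def)
  qed
qed

text \<open>An arc into \<open>v\<close> puts the image into some \<open>K\<^sub>2\<close> part, an
  arc out of \<open>v\<close> into some \<open>C\<^sub>5\<close> part. An \<open>Inner\<close>
  vertex lies in one part of one copy only, so the image is a \<open>Base\<close> vertex.\<close>

lemma gadget_graph_hom_preserves_Base:
  assumes D2: "digraph D2" "colorable 4 (mk_symmetric D2)"
    and \<psi>: "hom \<psi> (with_proj (gadget_graph D1)) (with_proj (gadget_graph D2))"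
    and v: "in_arcs D1 v \<noteq> {}" "out_arcs D1 v \<noteq> {}"
  shows "\<psi> (Base v) \<in> range Base"
proof -
  obtain a a' where a: "a \<in> arcs D1" "head D1 a = v" and a': "a' \<in> arcs D1" "tail D1 a' = v"
    using v by (auto simp: in_arcs_def out_arcs_def)
  obtain b where "\<psi> (Base v) \<in> place D2 b ` range Inl"
    using gadget_graph_hom_arc[OF D2 \<psi> a(1)] a(2) by metis
  moreover obtain b' where "\<psi> (Base v) \<in> place D2 b' ` range Inr"
    using gadget_graph_hom_arc[OF D2 \<psi> a'(1)] a'(2) by metis
  ultimately show ?thesis by (auto simp: place_def split: if_splits)
qed

theorem theorem44:
  fixes D1 :: "('v, 'a) pre_digraph" and D2 :: "('w, 'b) pre_digraph"
  assumes "digraph D1" and "digraph D2"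
    and "colorable 4 (mk_symmetric D2)"
  shows "((\<exists>\<phi>. hom \<phi> D1 D2) \<longleftrightarrow> (\<exists>\<psi>. hom \<psi> (gadget_graph D1) (gadget_graph D2)))
    \<and> (\<forall>\<psi>. hom \<psi> (gadget_graph D1) (gadget_graph D2)
          \<and> (\<forall>v \<in> verts D1. in_arcs D1 v = {} \<or> out_arcs D1 v = {}
                \<longrightarrow> \<psi> (Base v) \<in> Base ` verts D2)
        \<longrightarrow> (\<exists>\<phi>. hom \<phi> D1 D2 \<and> (\<forall>v \<in> verts D1. \<psi> (Base v) = Base (\<phi> v))))"
proof (intro conjI allI impI)
  show "(\<exists>\<phi>. hom \<phi> D1 D2) \<longleftrightarrow> (\<exists>\<psi>. hom \<psi> (gadget_graph D1) (gadget_graph D2))"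
    using hom_imp_gadget_graph_hom gadget_graph_hom_imp_hom[OF assms(2,3)] by blast
next
  fix \<psi> :: "('v, 'a) gvert \<Rightarrow> ('w, 'b) gvert"
  assume *: "hom \<psi> (gadget_graph D1) (gadget_graph D2)
    \<and> (\<forall>v \<in> verts D1. in_arcs D1 v = {} \<or> out_arcs D1 v = {} \<longrightarrow> \<psi> (Base v) \<in> Base ` verts D2)"
  then have "\<psi> (Base v) \<in> range Base" if "v \<in> verts D1" for v
    using gadget_graph_hom_preserves_Base[OF assms(2,3), of \<psi> D1 v] that
    by (metis image_mono subset_UNIV subsetD)
  \<comment> \<open>On the base \<open>gadget_end\<close> only strips the constructor, so the
    homomorphism it induces is the restriction of \<open>\<psi>\<close>.\<close>
  then have "\<psi> (Base v) = Base (gadget_end D2 (\<psi> (Base v)))" if "v \<in> verts D1" for v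
    using that by force
  then show "\<exists>\<phi>. hom \<phi> D1 D2 \<and> (\<forall>v \<in> verts D1. \<psi> (Base v) = Base (\<phi> v))"
    using gadget_graph_hom_imp_hom[OF assms(2,3)] * by blast
qed

end
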